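(* For each of the following four relations there exist a Markov Decision Process with a finite state space, a state $x$, and a policy $\pi$ for which the relation holds: (1) $w_*(x,\pi)<\underline{w}(x,\pi)<\overline{w}(x,\pi)<w^*(x,\pi)$; (2) $w_*(x,\pi)=\underline{w}(x,\pi)<\overline{w}(x,\pi)=w^*(x,\pi)$; (3) $w_*(x,\pi)<\underline{w}(x,\pi)<\overline{w}(x,\pi)=w^*(x,\pi)$; (4) $w_*(x,\pi)=\underline{w}(x,\pi)<\overline{w}(x,\pi)<w^*(x,\pi)$.
   Context: A Markov Decision Process (MDP) consists of: a nonempty countable (finite or countably infinite) state space $\mathbb{X}$; a measurable action space $(\mathbb{A},\mathcal{A})$ in which all singletons are measurable; for each $x\in\mathbb{X}$ a nonempty set of available actions $A(x)\in\mathcal{A}$; transition probabilities $p(y|x,a)$ ($x,y\in\mathbb{X}$, $a\in A(x)$), where $p(\cdot|x,a)$ is a probability mass function on $\mathbb{X}$ and $p(y|x,\cdot)$ is measurable on $A(x)$; and one-step costs $c(x,a)$ ($x\in\mathbb{X}$, $a\in A(x)$) that are real, uniformly bounded below, with $c(x,\cdot)$ measurable on $A(x)$. Let $\mathbb{H}_n=\mathbb{X}\times(\mathbb{A}\times\mathbb{X})^n$, $n=0,1,\ldots$, with the product sigma-field $\mathcal{F}_n$ (all subsets on $\mathbb{X}$, $\mathcal{A}$ on $\mathbb{A}$). A policy $\pi=\{\pi_n\}_{n=0,1,\ldots}$ is a sequence of transition probabilities from $\mathbb{H}_n$ to $\mathbb{A}$: for each $h_n=x_0a_0x_1\ldots a_{n-1}x_n\in\mathbb{H}_n$,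 $\pi_n(\cdot|h_n)$ is a probability on $(\mathbb{A},\mathcal{A})$ with $\pi_n(A(x_n)|h_n)=1$, and $\pi_n(B|\cdot)$ is $\mathcal{F}_n$-measurable for each $B\in\mathcal{A}$. An initial state $x$ and a policy $\pi$ define (by the Ionescu Tulcea theorem) a probability measure on trajectories $x_0a_0x_1a_1\ldots$ with $x_0=x$; $\mathbb{E}_x^\pi$ denotes its expectation. For $\alpha\in[0,1)$ let $v_\alpha(x,\pi)=\mathbb{E}_x^\pi\sum_{n=0}^\infty\alpha^n c(x_n,a_n)$. Define $$w^*(x,\pi)=\limsup_{N\to\infty}\frac1N\mathbb{E}_x^\pi\sum_{n=0}^{N-1}c(x_n,a_n),\qquad w_*(x,\pi)=\liminf_{N\to\infty}\frac1N\mathbb{E}_x^\pi\sum_{n=0}^{N-1}c(x_n,a_n),$$ $$\overline{w}(x,\pi)=\limsup_{\alpha\to1-}(1-\alpha)v_\alpha(x,\pi),\qquad \underline{w}(x,\pi)=\liminf_{\alpha\to1-}(1-\alpha)v_\alpha(x,\pi).$$ *)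

theory Defs
  imports "HOL-Probability.Probability"
begin

text \<open>
  The value of \<open>transition M x a\<close> and \<open>cost M x a\<close> matters only for \<open>x \<in> states M\<close> and \<open>a \<in> avail M x\<close>.
\<close>

record ('s, 'a) mdp =
  states :: "'s set"
  actions :: "'a measure"
  avail :: "'s \<Rightarrow> 'a set"
  transition :: "'s \<Rightarrow> 'a \<Rightarrow> 's pmf"
  cost :: "'s \<Rightarrow> 'a \<Rightarrow> real"

definition is_mdp :: "('s, 'a) mdp \<Rightarrow> bool" where
  "is_mdp M \<longleftrightarrow>
     states M \<noteq> {} \<and> countable (states M) \<and>
     (\<forall>a \<in> space (actions M). {a} \<in> sets (actions M)) \<and>
     (\<forall>x \<in> states M. avail M x \<in> sets (actions M) \<and> avail M x \<noteq> {}) \<and>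
     (\<forall>x \<in> states M. \<forall>a \<in> avail M x. set_pmf (transition M x a) \<subseteq> states M) \<and>
     (\<forall>x \<in> states M. \<forall>y \<in> states M.
        (\<lambda>a. pmf (transition M x a) y) \<in> borel_measurable (restrict_space (actions M) (avail M x))) \<and>
     (\<exists>K. \<forall>x \<in> states M. \<forall>a \<in> avail M x. K \<le> cost M x a) \<and>
     (\<forall>x \<in> states M. cost M x \<in> borel_measurable (restrict_space (actions M) (avail M x)))"

text \<open>
  A trajectory is stored as its sequence of state-action pairs \<open>n \<mapsto> (x\<^sub>n, a\<^sub>n)\<close>. Accordingly a
  history \<open>x\<^sub>0 a\<^sub>0 x\<^sub>1 \<dots> a\<^sub>n\<^sub>-\<^sub>1 x\<^sub>n\<close> is the pair consisting of \<open>(x\<^sub>i, a\<^sub>i)\<close> for \<open>i < n\<close> and of the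
  current state \<open>x\<^sub>n\<close>.
\<close>

definition step_space :: "('s, 'a) mdp \<Rightarrow> ('s \<times> 'a) measure" where
  "step_space M = count_space (states M) \<Otimes>\<^sub>M actions M"

definition history_space :: "('s, 'a) mdp \<Rightarrow> nat \<Rightarrow> ((nat \<Rightarrow> 's \<times> 'a) \<times> 's) measure" where
  "history_space M n =
     (\<Pi>\<^sub>M i \<in> {0..<n}. step_space M) \<Otimes>\<^sub>M count_space (states M)"

type_synonym ('s, 'a) policy = "nat \<Rightarrow> (nat \<Rightarrow> 's \<times> 'a) \<times> 's \<Rightarrow> 'a measure"

definition is_policy :: "('s, 'a) mdp \<Rightarrow> ('s, 'a) policy \<Rightarrow> bool" where
  "is_policy M \<pi> \<longleftrightarrow>
     (\<forall>n. \<forall>h \<in> space (history_space M n).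
        sets (\<pi> n h) = sets (actions M) \<and> prob_space (\<pi> n h) \<and>
        emeasure (\<pi> n h) (avail M (snd h)) = 1) \<and>
     (\<forall>n. \<forall>B \<in> sets (actions M).
        (\<lambda>h. emeasure (\<pi> n h) B) \<in> borel_measurable (history_space M n))"

text \<open>
  The conditional law of \<open>x\<^sub>n\<close> given the first \<open>n\<close> state-action pairs. The kernels of the
  Ionescu-Tulcea construction have to be total, so an unavailable action leaves the state
  unchanged; this happens with probability 0 under every policy.
\<close>

definition state_kernel ::
    "('s, 'a) mdp \<Rightarrow> 's \<Rightarrow> nat \<Rightarrow> (nat \<Rightarrow> 's \<times> 'a) \<Rightarrow> 's measure" where
  "state_kernel M x n \<omega> =
     (case n of
        0 \<Rightarrow> return (count_space (states M)) x
      | Suc m \<Rightarrow>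
          (let (y, a) = \<omega> m in
           if a \<in> avail M y then restrict_space (measure_pmf (transition M y a)) (states M)
           else return (count_space (states M)) y))"

definition step_kernel ::
    "('s, 'a) mdp \<Rightarrow> ('s, 'a) policy \<Rightarrow> 's \<Rightarrow> nat \<Rightarrow> (nat \<Rightarrow> 's \<times> 'a) \<Rightarrow> ('s \<times> 'a) measure" where
  "step_kernel M \<pi> x n \<omega> =
     state_kernel M x n \<omega> \<bind> (\<lambda>y. distr (\<pi> n (\<omega>, y)) (step_space M) (Pair y))"

text \<open>The Ionescu-Tulcea measure; \<open>is_mdp_Ionescu_Tulcea\<close> below shows that the locale applies.\<close>

definition trajectory_measure ::
    "('s, 'a) mdp \<Rightarrow> 's \<Rightarrow> ('s, 'a) policy \<Rightarrow> (nat \<Rightarrow> 's \<times> 'a) measure" where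
  "trajectory_measure M x \<pi> =
     projective_family.lim UNIV
       (Ionescu_Tulcea.CI (step_kernel M \<pi> x) (\<lambda>_. step_space M)) (\<lambda>_. step_space M)"

text \<open>
  Costs are real and bounded below, but not necessarily above, so expectations take values in
  \<open>(-\<infinity>, \<infinity>]\<close>: positive part minus (bounded) negative part.
\<close>

definition ereal_expectation :: "'b measure \<Rightarrow> ('b \<Rightarrow> ereal) \<Rightarrow> ereal" where
  "ereal_expectation P f =
     enn2ereal (\<integral>\<^sup>+\<omega>. e2ennreal (f \<omega>) \<partial>P) - enn2ereal (\<integral>\<^sup>+\<omega>. e2ennreal (- f \<omega>) \<partial>P)"

text \<open>The extension by 0 makes the cost measurable; unavailable actions have probability 0.\<close>

definition step_cost :: "('s, 'a) mdp \<Rightarrow> 's \<times> 'a \<Rightarrow> real" where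
  "step_cost M = (\<lambda>(x, a). if a \<in> avail M x then cost M x a else 0)"

definition discounted_cost :: "('s, 'a) mdp \<Rightarrow> real \<Rightarrow> 's \<Rightarrow> ('s, 'a) policy \<Rightarrow> ereal" where
  "discounted_cost M \<alpha> x \<pi> =
     ereal_expectation (trajectory_measure M x \<pi>) (\<lambda>\<omega>. \<Sum>n. ereal (\<alpha> ^ n * step_cost M (\<omega> n)))"

definition average_cost :: "('s, 'a) mdp \<Rightarrow> nat \<Rightarrow> 's \<Rightarrow> ('s, 'a) policy \<Rightarrow> ereal" where
  "average_cost M N x \<pi> =
     ereal (1 / real N) *
     ereal_expectation (trajectory_measure M x \<pi>) (\<lambda>\<omega>. ereal (\<Sum>n<N. step_cost M (\<omega> n)))"

definition upper_average :: "('s, 'a) mdp \<Rightarrow> 's \<Rightarrow> ('s, 'a) policy \<Rightarrow> ereal" where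
  "upper_average M x \<pi> = limsup (\<lambda>N. average_cost M N x \<pi>)"

definition lower_average :: "('s, 'a) mdp \<Rightarrow> 's \<Rightarrow> ('s, 'a) policy \<Rightarrow> ereal" where
  "lower_average M x \<pi> = liminf (\<lambda>N. average_cost M N x \<pi>)"

definition upper_abel :: "('s, 'a) mdp \<Rightarrow> 's \<Rightarrow> ('s, 'a) policy \<Rightarrow> ereal" where
  "upper_abel M x \<pi> = Limsup (at_left 1) (\<lambda>\<alpha>. ereal (1 - \<alpha>) * discounted_cost M \<alpha> x \<pi>)"

definition lower_abel :: "('s, 'a) mdp \<Rightarrow> 's \<Rightarrow> ('s, 'a) policy \<Rightarrow> ereal" where
  "lower_abel M x \<pi> = Liminf (at_left 1) (\<lambda>\<alpha>. ereal (1 - \<alpha>) * discounted_cost M \<alpha> x \<pi>)"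

lemma space_step: "space (step_space M) = states M \<times> space (actions M)"
  by (simp add: step_space_def space_pair_measure)

lemma sets_restrict_pmf:
  "sets (restrict_space (measure_pmf p) X) = sets (count_space X)"
  by (auto simp: sets_restrict_space image_iff)

lemma prob_space_restrict_pmf:
  assumes "set_pmf p \<subseteq> X" shows "prob_space (restrict_space (measure_pmf p) X)"
proof (rule prob_spaceI)
  have "AE y in measure_pmf p. y \<in> X" using assms by (auto simp: AE_measure_pmf_iff)
  then have "emeasure (measure_pmf p) X = 1" 
    using measure_pmf.emeasure_eq_1_AE[of X p] by auto
  then show "emeasure (restrict_space (measure_pmf p) X) (space (restrict_space (measure_pmf p) X)) = 1"
    by (simp add: emeasure_restrict_space space_restrict_space)
qed

lemma one_step_measurable:
  assumes M: "is_mdp M"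
  shows "(\<lambda>(y, a). if a \<in> avail M y then restrict_space (measure_pmf (transition M y a)) (states M)
           else return (count_space (states M)) y)
         \<in> measurable (step_space M) (prob_algebra (count_space (states M)))"
    (is "?K \<in> _")
proof (intro measurable_prob_algebraI measurable_subprob_algebra)
  fix z assume "z \<in> space (step_space M)"
  then obtain y a where z: "z = (y, a)" "y \<in> states M" "a \<in> space (actions M)"
    by (auto simp: space_step)
  show "prob_space (?K z)"
  proof (cases "a \<in> avail M y")
    case True
    then have "set_pmf (transition M y a) \<subseteq> states M"
      using M z unfolding is_mdp_def by blast
    then show ?thesis
      using True z by (simp add: prob_space_restrict_pmf)
  next
    case False
    then show ?thesis
      using z by (simp add: prob_space_return)
  qed
  then show "subprob_space (?K z)"
    by (rule prob_space_imp_subprob_space)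
  show "sets (?K z) = sets (count_space (states M))"
    using z by (auto simp: sets_restrict_pmf)
next
  fix B assume "B \<in> sets (count_space (states M))"
  then have B: "B \<subseteq> states M" by simp
  have cnt: "countable (states M)" using M by (simp add: is_mdp_def)
  then have cB: "countable B" using B countable_subset by blast
  have "(\<lambda>a. emeasure (?K (y, a)) B) \<in> borel_measurable (actions M)" if y: "y \<in> states M" for y
  proof -
    have av: "avail M y \<in> sets (actions M)" using M y by (simp add: is_mdp_def)
    have 1: "emeasure (?K (y, a)) B =
        (if a \<in> avail M y then \<integral>\<^sup>+z. ennreal (pmf (transition M y a) z) \<partial>count_space B else indicator B y)" for a
      using B by (auto simp: emeasure_restrict_space nn_integral_pmf)
    have 2: "(\<lambda>a. \<integral>\<^sup>+z. ennreal (pmf (transition M y a) z) \<partial>count_space B)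
        \<in> borel_measurable (restrict_space (actions M) (avail M y))"
    proof (rule sigma_finite_measure.borel_measurable_nn_integral)
      show "sigma_finite_measure (count_space B)"
        using cB by (rule sigma_finite_measure_count_space_countable)
      show "case_prod (\<lambda>a z. ennreal (pmf (transition M y a) z))
          \<in> borel_measurable (restrict_space (actions M) (avail M y) \<Otimes>\<^sub>M count_space B)"
      proof (subst measurable_pair_swap_iff)
        have "(\<lambda>a. ennreal (pmf (transition M y a) z))
            \<in> borel_measurable (restrict_space (actions M) (avail M y))" if "z \<in> B" for z
          using M y B that by (intro measurable_compose[OF _ measurable_ennreal]) (auto simp: is_mdp_def)
        then show "(\<lambda>(z, a). case (a, z) of (a, z) \<Rightarrow> ennreal (pmf (transition M y a) z))
            \<in> borel_measurable (count_space B \<Otimes>\<^sub>M restrict_space (actions M) (avail M y))"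
          using cB by (intro measurable_pair_measure_countable1) auto
      qed
    qed
    show ?thesis unfolding 1
    proof (subst measurable_If_restrict_space_iff)
      have "{a \<in> space (actions M). a \<in> avail M y} = avail M y"
        using sets.sets_into_space[OF av] by auto
      then show "{a \<in> space (actions M). a \<in> avail M y} \<in> sets (actions M)"
        using av by simp
    qed (use 2 in simp)
  qed
  then show "(\<lambda>z. emeasure (?K z) B) \<in> borel_measurable (step_space M)"
    unfolding step_space_def using cnt
    by (intro measurable_pair_measure_countable1) auto
qed

lemma state_kernel_measurable:
  assumes M: "is_mdp M" and x: "x \<in> states M"
  shows "state_kernel M x n \<in>
    measurable (\<Pi>\<^sub>M i \<in> {0..<n}. step_space M) (prob_algebra (count_space (states M)))"
proof (cases n)
  case 0
  then show ?thesis
    using x by (auto simp: state_kernel_def[abs_def] space_prob_algebra prob_space_return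
        intro!: measurable_const)
next
  case (Suc m)
  have "(\<lambda>\<omega>. \<omega> m) \<in> measurable (\<Pi>\<^sub>M i \<in> {0..<n}. step_space M) (step_space M)"
    using Suc by (intro measurable_component_singleton) auto
  from measurable_compose[OF this one_step_measurable[OF M]] show ?thesis
    by (simp add: state_kernel_def[abs_def] Suc Let_def)
qed

lemma is_policy_measurable:
  assumes "is_policy M \<pi>"
  shows "\<pi> n \<in> measurable (history_space M n) (prob_algebra (actions M))"
  using assms unfolding is_policy_def
  by (intro measurable_prob_algebraI measurable_subprob_algebra)
     (auto intro: prob_space_imp_subprob_space)

lemma step_kernel_measurable:
  assumes M: "is_mdp M" and x: "x \<in> states M" and \<pi>: "is_policy M \<pi>"
  shows "step_kernel M \<pi> x n \<in>
    measurable (\<Pi>\<^sub>M i \<in> {0..<n}. step_space M) (prob_algebra (step_space M))"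
proof -
  let ?H = "\<Pi>\<^sub>M i \<in> {0..<n}. step_space M" and ?S = "count_space (states M)"
  note [measurable] = is_policy_measurable[OF \<pi>, of n, unfolded history_space_def]
  have "(\<lambda>h. distr (\<pi> n h) (step_space M) (Pair (snd h)))
      \<in> measurable (?H \<Otimes>\<^sub>M ?S) (prob_algebra (step_space M))"
    by (rule measurable_distr_prob_space2[where M = "actions M"])
       (measurable, simp add: step_space_def)
  then show ?thesis
    unfolding step_kernel_def[abs_def]
    by (intro measurable_bind_prob_space2[OF state_kernel_measurable[OF M x]])
       (simp add: case_prod_beta')
qed

lemma is_mdp_Ionescu_Tulcea:
  assumes "is_mdp M" and "x \<in> states M" and "is_policy M \<pi>"
  shows "Ionescu_Tulcea (step_kernel M \<pi> x) (\<lambda>_. step_space M)"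
proof (rule Ionescu_Tulcea.intro)
  note K = step_kernel_measurable[OF assms]
  from K show "step_kernel M \<pi> x n \<in>
      measurable (\<Pi>\<^sub>M i \<in> {0..<n}. step_space M) (subprob_algebra (step_space M))" for n
    by (rule measurable_prob_algebraD)
  show "prob_space (step_kernel M \<pi> x n \<omega>)"
    if "\<omega> \<in> space (\<Pi>\<^sub>M i \<in> {0..<n}. step_space M)" for n \<omega>
    using measurable_space[OF K that] by (simp add: space_prob_algebra)
qed

end

theory Submission
  imports Defs
begin

text \<open>
  In an MDP with a single state, a deterministic policy produces an arbitrary bounded cost sequence
  \<open>c\<close>, so it suffices to compare the Cesaro and Abel means of such sequences. Fix levels \<open>L\<^sub>k\<close> with
  \<open>L\<^sub>k\<^sub>+\<^sub>1 = L\<^sub>k\<^sup>3\<close> and let \<open>c\<close> be 1 on the blocks \<open>[L\<^sub>k, 2L\<^sub>k)\<close> and 0 elsewhere. At the end of a block the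
  Cesaro mean is close to 1/2, whereas a single block contributes \<open>x - x\<^sup>2 \<le> 1/4\<close> to the Abel mean,
  where \<open>x\<close> is \<open>\<alpha>\<close> to the power \<open>L\<^sub>k\<close>; the other blocks are negligible because at most one \<open>L\<^sub>k\<close> is
  comparable with \<open>1/(1 - \<alpha>)\<close>. In the gaps both means tend to 0. This is (4); negating \<open>c\<close> gives
  (3), alternating the signs of the blocks gives (1). For (2) take \<open>c\<close> equal to 1 on \<open>[L\<^sub>k, L\<^sub>k\<^sub>+\<^sub>1)\<close> for
  even \<open>k\<close> and 0 for odd \<open>k\<close>, so that both means oscillate between 0 and 1.
\<close>

subsection \<open>Deterministic policies in a single-state MDP\<close>

text \<open>Induction on \<open>n\<close>: binding a Dirac measure with the next kernel evaluates
  that kernel at a single point, and the kernel is again Dirac there. The law of the first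
  \<open>n\<close> steps is thus concentrated on one history.\<close>

lemma (in Ionescu_Tulcea) C_return:
  assumes P_return: "\<And>n \<omega>. \<omega> \<in> space (PiM {0..<n} M) \<Longrightarrow> P n \<omega> = return (M n) (z n)"
    and z: "\<And>n. z n \<in> space (M n)"
  shows "C 0 n (\<lambda>_. undefined) = return (PiM {0..<n} M) (restrict z {0..<n})"
proof (induction n)
  case 0
  then show ?case by (simp add: restrict_def)
next
  case (Suc n)
  have sp: "restrict z {0..<n} \<in> space (PiM {0..<n} M)"
    using z by (auto simp: space_PiM)
  have upd: "(restrict z {0..<n})(n := z n) = restrict z {0..<Suc n}"
    by (auto simp: fun_eq_iff restrict_def)
  have "C 0 (Suc n) (\<lambda>_. undefined) = eP n (restrict z {0..<n})"
    using bind_return[OF measurable_eP[of n] sp] unfolding C.simps(2) Suc by simp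
  also have "\<dots> = return (PiM {0..<Suc n} M) (restrict z {0..<Suc n})"
    unfolding eP_def P_return[OF sp] using z sp
    by (subst distr_return) (auto simp: upd intro!: measurable_fun_upd[where J="{0..<n}"])
  finally show ?case .
qed

text \<open>The whole space is the cylinder over the empty index set, so its mass is that of the
  empty product.\<close>

lemma (in Ionescu_Tulcea) prob_space_lim: "prob_space PF.lim"
proof (rule prob_spaceI)
  have *: "space (PiM {} M) \<in> sets (PiM {} M)"
    by simp
  have "PF.emb UNIV {} (space (PiM {} M)) = space PF.lim"
    by (auto simp: PF.space_lim prod_emb_def space_PiM PiE_def restrict_def)
  then show "emeasure PF.lim (space PF.lim) = 1"
    using lim[OF finite.emptyI *] prob_space.emeasure_space_1[OF PF.prob_space_P[of "{}"]]
    by (simp add: PF.space_P)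
qed

text \<open>For a single \<open>n\<close> the event is a cylinder over \<open>{n}\<close>; its mass
  is computed after \<open>Suc n\<close> steps, where \<open>C_return\<close> gives a Dirac measure.
  The countably many almost sure events are then intersected.\<close>

lemma (in Ionescu_Tulcea) AE_lim_eq:
  assumes P_return: "\<And>n \<omega>. \<omega> \<in> space (PiM {0..<n} M) \<Longrightarrow> P n \<omega> = return (M n) (z n)"
    and z: "\<And>n. {z n} \<in> sets (M n)"
  shows "AE \<omega> in PF.lim. \<forall>n. \<omega> n = z n"
proof (subst AE_all_countable, rule allI)
  fix n
  have z': "z m \<in> space (M m)" for m
    using sets.sets_into_space[OF z[of m]] by auto
  let ?X = "PiE {n} (\<lambda>i. {z i})"
  have X: "?X \<in> sets (PiM {n} M)"
    using z by (intro sets_PiM_I_finite) auto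
  have X': "PF.emb {0..<Suc n} {n} ?X \<in> sets (PiM {0..<Suc n} M)"
    using X by (intro measurable_prod_emb) auto
  have mem: "restrict z {0..<Suc n} \<in> PF.emb {0..<Suc n} {n} ?X"
    using z' by (auto simp: prod_emb_def space_PiM)
  have "emeasure PF.lim (PF.emb UNIV {n} ?X) = emeasure (CI {n}) ?X"
    using X by (intro lim) auto
  also have "\<dots> = emeasure (C 0 (Suc n) (\<lambda>_. undefined)) (PF.emb {0..<Suc n} {n} ?X)"
    using X by (intro emeasure_CI) auto
  also have "\<dots> = 1"
    using X' mem by (subst C_return[of z, OF P_return z']) (auto simp: indicator_def)
  finally have 1: "emeasure PF.lim (PF.emb UNIV {n} ?X) = 1" .
  interpret L: prob_space PF.lim
    by (rule prob_space_lim)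
  have "AE \<omega> in PF.lim. \<omega> \<in> PF.emb UNIV {n} ?X"
    using 1 by (intro L.AE_prob_1) (simp add: L.emeasure_eq_measure)
  then show "AE \<omega> in PF.lim. \<omega> n = z n"
    by eventually_elim (auto simp: prod_emb_def PiE_iff)
qed

text \<open>The action is itself the cost paid, so a deterministic policy is the same as a cost
  sequence. Availability is cut down to \<open>{-1..1}\<close> to keep the costs bounded
  below.\<close>

definition seq_mdp :: "(nat, real) mdp" where
  "seq_mdp = \<lparr>states = {0}, actions = borel, avail = \<lambda>_. {-1..1},
     transition = \<lambda>_ _. return_pmf 0, cost = \<lambda>_ a. a\<rparr>"

definition seq_policy :: "(nat \<Rightarrow> real) \<Rightarrow> (nat, real) policy" where
  "seq_policy c n h = return borel (c n)"

lemma is_mdp_seq_mdp: "is_mdp seq_mdp"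
  by (auto simp: is_mdp_def seq_mdp_def intro!: exI[of _ "-1"] measurable_restrict_space1)

lemma is_policy_seq_policy:
  assumes "\<And>n. \<bar>c n\<bar> \<le> 1"
  shows "is_policy seq_mdp (seq_policy c)"
proof -
  have "c n \<in> {-1..1}" for n using assms[of n] by auto
  then show ?thesis
    by (auto simp: is_policy_def seq_mdp_def seq_policy_def prob_space_return)
qed

lemma step_kernel_seq:
  assumes "\<omega> \<in> space (PiM {0..<n} (\<lambda>_. step_space seq_mdp))"
  shows "step_kernel seq_mdp (seq_policy c) 0 n \<omega> = return (step_space seq_mdp) (0, c n)"
proof -
  have restr: "restrict_space (measure_pmf (return_pmf 0)) {0} = return (count_space {0}) (0::nat)"
    by (rule measure_eqI) (auto simp: sets_restrict_pmf emeasure_restrict_space subset_singleton_iff)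
  have "fst (\<omega> m) = 0" if "n = Suc m" for m
  proof -
    have "\<omega> m \<in> space (step_space seq_mdp)"
      using assms that by (auto simp: space_PiM)
    then show ?thesis by (auto simp: space_step seq_mdp_def)
  qed
  then have st: "state_kernel seq_mdp 0 n \<omega> = return (count_space {0}) 0"
    using restr by (auto simp: state_kernel_def seq_mdp_def split: nat.split prod.split)
  have "distr (seq_policy c n h) (step_space seq_mdp) (Pair 0) = return (step_space seq_mdp) (0, c n)" for h
    unfolding seq_policy_def by (subst distr_return) (auto simp: step_space_def seq_mdp_def)
  moreover have "return (step_space seq_mdp) (0, c n) \<in> space (subprob_algebra (step_space seq_mdp))"
    by (auto simp: space_subprob_algebra space_step seq_mdp_def intro!: prob_space_imp_subprob_space prob_space_return)
  ultimately show ?thesis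
    unfolding step_kernel_def st
    by (subst bind_return[where N="step_space seq_mdp"]) auto
qed

lemma
  assumes "\<And>n. \<bar>c n\<bar> \<le> 1"
  shows prob_space_trajectory_seq: "prob_space (trajectory_measure seq_mdp 0 (seq_policy c))" (is ?P)
    and AE_trajectory_seq: "AE \<omega> in trajectory_measure seq_mdp 0 (seq_policy c). \<forall>n. \<omega> n = (0, c n)" (is ?AE)
proof -
  interpret Ionescu_Tulcea "step_kernel seq_mdp (seq_policy c) 0" "\<lambda>_. step_space seq_mdp"
    using is_mdp_seq_mdp is_policy_seq_policy[OF assms]
    by (intro is_mdp_Ionescu_Tulcea) (auto simp: seq_mdp_def)
  show ?P unfolding trajectory_measure_def by (rule prob_space_lim)
  have "{(0, a)} \<in> sets (step_space seq_mdp)" for a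
  proof -
    have "{0} \<times> {a} \<in> sets (step_space seq_mdp)"
      unfolding step_space_def by (intro pair_measureI) (auto simp: seq_mdp_def)
    then show ?thesis by simp
  qed
  then show ?AE unfolding trajectory_measure_def
    by (intro AE_lim_eq step_kernel_seq)
qed

section \<open>Cost criteria of the one-state MDP as Cesaro and Abel means\<close>

lemma ereal_expectation_AE_const:
  assumes "prob_space P" and "AE \<omega> in P. f \<omega> = ereal r"
  shows "ereal_expectation P f = ereal r"
proof -
  interpret prob_space P by fact
  have "(\<integral>\<^sup>+\<omega>. e2ennreal (f \<omega>) \<partial>P) = (\<integral>\<^sup>+\<omega>. ennreal r \<partial>P)"
    using assms(2) by (intro nn_integral_cong_AE) (auto simp: e2ennreal_ereal)
  moreover have "(\<integral>\<^sup>+\<omega>. e2ennreal (- f \<omega>) \<partial>P) = (\<integral>\<^sup>+\<omega>. ennreal (- r) \<partial>P)"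
    using assms(2) by (intro nn_integral_cong_AE) (auto simp: e2ennreal_ereal)
  ultimately show ?thesis
    unfolding ereal_expectation_def
    by (cases "r \<ge> 0") (auto simp: emeasure_space_1 ennreal_neg zero_ennreal.rep_eq)
qed

definition cesaro :: "(nat \<Rightarrow> real) \<Rightarrow> nat \<Rightarrow> real" where
  "cesaro c N = (\<Sum>n<N. c n) / N"

definition abel :: "(nat \<Rightarrow> real) \<Rightarrow> real \<Rightarrow> real" where
  "abel c \<alpha> = (1 - \<alpha>) * (\<Sum>n. \<alpha> ^ n * c n)"

lemma summable_abel:
  fixes c :: "nat \<Rightarrow> real"
  assumes "\<And>n. \<bar>c n\<bar> \<le> 1" "0 < \<alpha>" "\<alpha> < 1"
  shows "summable (\<lambda>n. \<alpha> ^ n * c n)"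
proof (rule summable_comparison_test'[of "\<lambda>n. \<alpha> ^ n" 0])
  show "summable (\<lambda>n. \<alpha> ^ n)" using assms by (intro summable_geometric) auto
  show "norm (\<alpha> ^ n * c n) \<le> \<alpha> ^ n" for n
    using assms(1)[of n] assms(2) by (auto simp: abs_mult intro!: mult_left_le)
qed

lemma average_cost_seq:
  assumes "\<And>n. \<bar>c n\<bar> \<le> 1"
  shows "average_cost seq_mdp N 0 (seq_policy c) = ereal (cesaro c N)"
proof -
  have c: "- 1 \<le> c n" "c n \<le> 1" for n using assms[of n] by auto
  have "ereal_expectation (trajectory_measure seq_mdp 0 (seq_policy c))
      (\<lambda>\<omega>. ereal (\<Sum>n<N. step_cost seq_mdp (\<omega> n))) = ereal (\<Sum>n<N. c n)"
    using AE_trajectory_seq[of c, OF assms] c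
    by (intro ereal_expectation_AE_const prob_space_trajectory_seq assms)
       (auto simp: step_cost_def seq_mdp_def)
  then show ?thesis by (simp add: average_cost_def cesaro_def)
qed

lemma discounted_cost_seq:
  assumes "\<And>n. \<bar>c n\<bar> \<le> 1" and \<alpha>: "0 < \<alpha>" "\<alpha> < 1"
  shows "ereal (1 - \<alpha>) * discounted_cost seq_mdp \<alpha> 0 (seq_policy c) = ereal (abel c \<alpha>)"
proof -
  have c: "- 1 \<le> c n" "c n \<le> 1" for n using assms(1)[of n] by auto
  have "(\<Sum>n. ereal (\<alpha> ^ n * c n)) = ereal (\<Sum>n. \<alpha> ^ n * c n)"
    using summable_abel[of c, OF assms] by (intro sums_unique[symmetric]) (simp add: summable_sums sums_ereal)
  then have "discounted_cost seq_mdp \<alpha> 0 (seq_policy c) = ereal (\<Sum>n. \<alpha> ^ n * c n)"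
    unfolding discounted_cost_def using AE_trajectory_seq[of c, OF assms(1)] c
    by (intro ereal_expectation_AE_const prob_space_trajectory_seq assms)
       (auto simp: step_cost_def seq_mdp_def)
  then show ?thesis by (simp add: abel_def)
qed

lemma eventually_at_left_1: "\<forall>\<^sub>F \<alpha> in at_left (1::real). 0 < \<alpha> \<and> \<alpha> < 1"
  by (auto simp: eventually_at_left[of 0] intro!: exI[of _ 0])

text \<open>The bridge from MDPs to sequences: with it, each of the four relations becomes a
  statement about one real sequence.\<close>

lemma ex_mdp_cesaro_abel:
  assumes "\<And>n. \<bar>c n\<bar> \<le> 1"
  obtains M :: "(nat, real) mdp" and x \<pi> where
    "is_mdp M" "finite (states M)" "x \<in> states M" "is_policy M \<pi>"
    "lower_average M x \<pi> = liminf (\<lambda>N. ereal (cesaro c N))"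
    "upper_average M x \<pi> = limsup (\<lambda>N. ereal (cesaro c N))"
    "lower_abel M x \<pi> = Liminf (at_left 1) (\<lambda>\<alpha>. ereal (abel c \<alpha>))"
    "upper_abel M x \<pi> = Limsup (at_left 1) (\<lambda>\<alpha>. ereal (abel c \<alpha>))"
proof
  show "is_mdp seq_mdp" by (rule is_mdp_seq_mdp)
  show "is_policy seq_mdp (seq_policy c)" by (rule is_policy_seq_policy) fact
  show "finite (states seq_mdp)" "0 \<in> states seq_mdp" by (auto simp: seq_mdp_def)
  show "lower_average seq_mdp 0 (seq_policy c) = liminf (\<lambda>N. ereal (cesaro c N))"
    "upper_average seq_mdp 0 (seq_policy c) = limsup (\<lambda>N. ereal (cesaro c N))"
    unfolding lower_average_def upper_average_def by (simp_all add: average_cost_seq assms)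
  \<comment> \<open>The identity is known only for \<open>0 < \<alpha>\<close> and
    \<open>\<alpha> < 1\<close>, which is enough for limits at 1 from the left.\<close>
  have *: "\<forall>\<^sub>F \<alpha> in at_left 1. ereal (1 - \<alpha>) * discounted_cost seq_mdp \<alpha> 0 (seq_policy c) = ereal (abel c \<alpha>)"
    using eventually_at_left_1 by eventually_elim (simp add: discounted_cost_seq assms)
  show "lower_abel seq_mdp 0 (seq_policy c) = Liminf (at_left 1) (\<lambda>\<alpha>. ereal (abel c \<alpha>))"
    unfolding lower_abel_def using * by (rule Liminf_eq)
  show "upper_abel seq_mdp 0 (seq_policy c) = Limsup (at_left 1) (\<lambda>\<alpha>. ereal (abel c \<alpha>))"
    unfolding upper_abel_def using * by (rule Limsup_eq)
qed

subsection \<open>Cesaro and Abel means of bounded sequences\<close>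

lemma abel_uminus:
  assumes "\<And>n. \<bar>c n\<bar> \<le> 1" "0 < \<alpha>" "\<alpha> < 1"
  shows "abel (\<lambda>n. - c n) \<alpha> = - abel c \<alpha>"
  using suminf_minus[OF summable_abel[of c, OF assms]] by (simp add: abel_def)

lemma cesaro_uminus: "cesaro (\<lambda>n. - c n) N = - cesaro c N"
  by (simp add: cesaro_def sum_negf)

definition cesaro_inf :: "(nat \<Rightarrow> real) \<Rightarrow> ereal" where
  "cesaro_inf c = liminf (\<lambda>N. ereal (cesaro c N))"

definition cesaro_sup :: "(nat \<Rightarrow> real) \<Rightarrow> ereal" where
  "cesaro_sup c = limsup (\<lambda>N. ereal (cesaro c N))"

definition abel_inf :: "(nat \<Rightarrow> real) \<Rightarrow> ereal" where
  "abel_inf c = Liminf (at_left 1) (\<lambda>\<alpha>. ereal (abel c \<alpha>))"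

definition abel_sup :: "(nat \<Rightarrow> real) \<Rightarrow> ereal" where
  "abel_sup c = Limsup (at_left 1) (\<lambda>\<alpha>. ereal (abel c \<alpha>))"

text \<open>Negation exchanges upper and lower limits. This turns upper estimates into lower ones
  and relation (4) into relation (3).\<close>

lemma cesaro_inf_uminus: "cesaro_inf (\<lambda>n. - c n) = - cesaro_sup c"
  using ereal_Liminf_uminus[of sequentially "\<lambda>N. ereal (cesaro c N)"]
  by (simp add: cesaro_inf_def cesaro_sup_def cesaro_uminus)

lemma cesaro_sup_uminus: "cesaro_sup (\<lambda>n. - c n) = - cesaro_inf c"
  using cesaro_inf_uminus[of "\<lambda>n. - c n"] by simp

lemma abel_inf_uminus:
  assumes "\<And>n. \<bar>c n\<bar> \<le> 1"
  shows "abel_inf (\<lambda>n. - c n) = - abel_sup c"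
proof -
  have "abel_inf (\<lambda>n. - c n) = Liminf (at_left 1) (\<lambda>\<alpha>. - ereal (abel c \<alpha>))"
    unfolding abel_inf_def
    by (intro Liminf_eq eventually_mono[OF eventually_at_left_1]) (simp add: abel_uminus assms)
  then show ?thesis by (simp only: ereal_Liminf_uminus abel_sup_def)
qed

lemma abel_sup_uminus:
  assumes "\<And>n. \<bar>c n\<bar> \<le> 1"
  shows "abel_sup (\<lambda>n. - c n) = - abel_inf c"
  using abel_inf_uminus[of "\<lambda>n. - c n"] assms by simp

lemma frequently_le_Limsup:
  fixes f :: "'a \<Rightarrow> ereal"
  assumes "\<exists>\<^sub>F x in F. l \<le> f x"
  shows "l \<le> Limsup F f"
proof (rule ccontr)
  assume "\<not> l \<le> Limsup F f"
  then have "\<forall>\<^sub>F x in F. f x < l" by (intro Limsup_lessD) simp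
  then show False using assms by (simp add: frequently_def not_le)
qed

lemma frequently_Liminf_le:
  fixes f :: "'a \<Rightarrow> ereal"
  assumes "\<exists>\<^sub>F x in F. f x \<le> l"
  shows "Liminf F f \<le> l"
  using frequently_le_Limsup[of "- l" "\<lambda>x. - f x" F] assms by (simp add: ereal_Limsup_uminus)

text \<open>Carries an estimate at sample points \<open>g k\<close>, valid for infinitely many
  \<open>k\<close>, over to the filter of the horizons \<open>N\<close> or of the discount factors
  \<open>\<alpha>\<close>.\<close>

lemma filterlim_frequently:
  assumes "filterlim g F G" and "\<exists>\<^sub>F k in G. P (g k)"
  shows "\<exists>\<^sub>F x in F. P x"
  using assms by (auto simp: frequently_def filterlim_iff)

text \<open>The Abel mean of the indicator of \<open>[m, \<infinity>)\<close> is a tail of the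
  geometric series. Bounding a sequence by combinations of such indicators gives all upper estimates
  of Abel means below.\<close>

lemma step_sums:
  fixes \<alpha> :: real
  assumes "0 < \<alpha>" "\<alpha> < 1"
  shows "(\<lambda>j. (1 - \<alpha>) * (\<alpha> ^ j * of_bool (m \<le> j))) sums \<alpha> ^ m"
proof -
  have "(\<lambda>j. (1 - \<alpha>) * \<alpha> ^ m * \<alpha> ^ j) sums ((1 - \<alpha>) * \<alpha> ^ m * (1 / (1 - \<alpha>)))"
    using assms by (intro sums_mult geometric_sums) auto
  then have "(\<lambda>j. (1 - \<alpha>) * (\<alpha> ^ (j + m) * of_bool (m \<le> j + m))) sums \<alpha> ^ m"
    using assms by (simp add: power_add mult_ac)
  \<comment> \<open>Undoing the shift adds the first \<open>m\<close> terms, all of which are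
    zero.\<close>
  then show ?thesis
    by (subst (asm) sums_iff_shift) simp
qed

text \<open>Abel means are monotone and linear, so a bound by step functions passes to the means.
  The majorant allows 1 before \<open>p\<close>, \<open>w\<close> on the block from \<open>q\<close>
  to \<open>r\<close>, and 1 from \<open>s\<close> on; a negative \<open>w\<close> is allowed, which
  is how lower bounds arise later.\<close>

lemma abel_le_steps:
  assumes c: "\<And>j. \<bar>c j\<bar> \<le> 1" and \<alpha>: "0 < \<alpha>" "\<alpha> < 1"
    and le: "\<And>j. c j \<le> 1 - of_bool (p \<le> j) + w * (of_bool (q \<le> j) - of_bool (r \<le> j)) + of_bool (s \<le> j)"
  shows "abel c \<alpha> \<le> 1 - \<alpha> ^ p + w * (\<alpha> ^ q - \<alpha> ^ r) + \<alpha> ^ s"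
proof (rule sums_le)
  let ?H = "\<lambda>m j. (1 - \<alpha>) * (\<alpha> ^ j * of_bool (m \<le> j))"
  show "(\<lambda>j. (1 - \<alpha>) * (\<alpha> ^ j * c j)) sums abel c \<alpha>"
    unfolding abel_def by (intro sums_mult summable_sums summable_abel c \<alpha>)
  show "(\<lambda>j. ?H 0 j - ?H p j + w * (?H q j - ?H r j) + ?H s j)
      sums (1 - \<alpha> ^ p + w * (\<alpha> ^ q - \<alpha> ^ r) + \<alpha> ^ s)"
    \<comment> \<open>The constant 1 is treated as the step at 0, with Abel mean
      \<open>\<alpha> ^ 0\<close>.\<close>
    using step_sums[OF \<alpha>, of 0]
    by (intro sums_add sums_diff sums_mult[of _ _ w] step_sums \<alpha>) simp
  show "(1 - \<alpha>) * (\<alpha> ^ j * c j) \<le> ?H 0 j - ?H p j + w * (?H q j - ?H r j) + ?H s j" for j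
  proof -
    have "(1 - \<alpha>) * \<alpha> ^ j * c j \<le> (1 - \<alpha>) * \<alpha> ^ j *
        (1 - of_bool (p \<le> j) + w * (of_bool (q \<le> j) - of_bool (r \<le> j)) + of_bool (s \<le> j))"
      using \<alpha> by (intro mult_left_mono le) auto
    then show ?thesis by (simp add: algebra_simps)
  qed
qed

subsection \<open>Lacunary sequences\<close>

text \<open>Starting at 8 makes consecutive levels differ by a factor of at least 64, which the
  numerical estimates use. Cubing leaves room for \<open>L\<^sup>2\<close> strictly between a level
  \<open>L\<close> and the next one.\<close>

definition level :: "nat \<Rightarrow> nat" where
  "level k = 8 ^ 3 ^ k"

lemma level_Suc: "level (Suc k) = level k ^ 3"
  by (simp add: level_def power_mult[symmetric] mult.commute)

lemma level_ge_8: "8 \<le> level k"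
  using power_increasing[of 1 "3 ^ k" "8::nat"] by (simp add: level_def)

lemma level_pos: "0 < level k"
  using level_ge_8[of k] by linarith

lemma level_gap: "64 * level k \<le> level (Suc k)"
  using power_mono[OF level_ge_8[of k], of 2] by (simp add: level_Suc power3_eq_cube power2_eq_square)

lemma strict_mono_level: "strict_mono level"
  by (rule strict_monoI_Suc) (use level_gap level_pos in \<open>force intro: less_le_trans[OF _ level_gap]\<close>)

lemma filterlim_level: "filterlim level at_top sequentially"
  by (rule filterlim_subseq[OF strict_mono_level])

lemma filterlim_real_level: "filterlim (\<lambda>k. real (level k)) at_top sequentially"
  by (rule filterlim_compose[OF filterlim_real_sequentially filterlim_level])

text \<open>On the blocks only boundedness is prescribed, so the notion is stable under negation and
  covers constant as well as alternating blocks.\<close>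

definition lacunary :: "(nat \<Rightarrow> real) \<Rightarrow> bool" where
  "lacunary c \<longleftrightarrow> (\<forall>j. \<bar>c j\<bar> \<le> 1) \<and> (\<forall>k j. 2 * level k \<le> j \<longrightarrow> j < level (Suc k) \<longrightarrow> c j = 0)"

lemma lacunary_uminus: "lacunary c \<Longrightarrow> lacunary (\<lambda>j. - c j)"
  by (auto simp: lacunary_def)

text \<open>All blocks other than the one at \<open>k + 1\<close> are estimated trivially by \<open>\<bar>c j\<bar> \<le> 1\<close>.\<close>

lemma abel_lacunary_le:
  assumes c: "lacunary c" and \<alpha>: "0 < \<alpha>" "\<alpha> < 1"
    and w: "\<And>j. level (Suc k) \<le> j \<Longrightarrow> j < 2 * level (Suc k) \<Longrightarrow> c j \<le> w"
  shows "abel c \<alpha> \<le> 1 - \<alpha> ^ (2 * level k)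
    + w * (\<alpha> ^ level (Suc k) - \<alpha> ^ (2 * level (Suc k))) + \<alpha> ^ level (Suc (Suc k))"
proof (rule abel_le_steps)
  show b: "\<bar>c j\<bar> \<le> 1" for j using c by (auto simp: lacunary_def)
  fix j
  have b': "c j \<le> 1" using b[of j] by auto
  have z: "c j = 0" if "2 * level k \<le> j" "j < level (Suc k)" for k
    using c that by (auto simp: lacunary_def)
  show "c j \<le> 1 - of_bool (2 * level k \<le> j)
      + w * (of_bool (level (Suc k) \<le> j) - of_bool (2 * level (Suc k) \<le> j)) + of_bool (level (Suc (Suc k)) \<le> j)"
    using level_gap[of k] level_gap[of "Suc k"] z[of k] z[of "Suc k"] w[of j] b' by auto
qed (use \<alpha> in auto)

section \<open>Upper limits of lacunary sequences\<close>

text \<open>For \<open>\<alpha>\<close> near 1 there is a \<open>k\<close> at which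
  \<open>\<alpha> ^ level k\<close> falls from above \<open>15 / 16\<close> to at most
  \<open>15 / 16\<close> at \<open>Suc k\<close>. The threshold is close enough to 1 to make
  everything up to block \<open>k\<close> small, while its 64th power already makes everything from
  block \<open>k + 2\<close> on small; block \<open>k + 1\<close> contributes at most
  \<open>1 / 4\<close>.\<close>

lemma eventually_abel_le:
  assumes c: "lacunary c"
  shows "\<forall>\<^sub>F \<alpha> in at_left 1. abel c \<alpha> \<le> 2 / 5"
proof -
  have "((\<lambda>\<alpha>::real. \<alpha> ^ level 0) \<longlongrightarrow> 1 ^ level 0) (at_left 1)"
    by (intro tendsto_intros)
  then have "\<forall>\<^sub>F \<alpha> in at_left (1::real). 15 / 16 < \<alpha> ^ level 0"
    by (rule order_tendstoD) simp
  then show ?thesis using eventually_at_left_1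
  proof eventually_elim
    case (elim \<alpha>)
    then have \<alpha>: "0 < \<alpha>" "\<alpha> < 1" by auto
    have "(\<lambda>k. \<alpha> ^ level k) \<longlonglongrightarrow> 0"
      using \<alpha> by (intro filterlim_compose[OF LIMSEQ_power_zero filterlim_level]) auto
    then have "\<forall>\<^sub>F k in sequentially. \<alpha> ^ level k < 15 / 16"
      by (rule order_tendstoD) simp
    then have "\<exists>k. \<alpha> ^ level k \<le> 15 / 16"
      by (auto simp: eventually_sequentially intro: less_imp_le)
    \<comment> \<open>The last index before the first drop below the threshold; it exists because
      \<open>level 0\<close> is still above it.\<close>
    then obtain k where k: "15 / 16 < \<alpha> ^ level k" "\<alpha> ^ level (Suc k) \<le> 15 / 16"
      using exists_least_lemma[of "\<lambda>k. \<alpha> ^ level k \<le> 15 / 16"] elim by (auto simp: not_le)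
    define x where "x = \<alpha> ^ level (Suc k)"
    have x: "0 \<le> x" "x \<le> 15 / 16" using k \<alpha> by (auto simp: x_def)
    have "abel c \<alpha> \<le> 1 - \<alpha> ^ (2 * level k)
        + 1 * (\<alpha> ^ level (Suc k) - \<alpha> ^ (2 * level (Suc k))) + \<alpha> ^ level (Suc (Suc k))"
      by (rule abel_lacunary_le[OF c \<alpha>]) (use c in \<open>auto simp: lacunary_def abs_le_iff\<close>)
    moreover have "(15 / 16) ^ 2 \<le> \<alpha> ^ (2 * level k)"
      using power_mono[of "15 / 16" "\<alpha> ^ level k" 2] k by (simp add: power_mult[symmetric] mult.commute)
    moreover have "\<alpha> ^ level (Suc k) - \<alpha> ^ (2 * level (Suc k)) \<le> 1 / 4"
    proof -
      have "\<alpha> ^ (2 * level (Suc k)) = x ^ 2"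
        by (simp add: x_def power_mult[symmetric] mult.commute)
      then show ?thesis
        using zero_le_power2[of "x - 1 / 2"] by (simp add: x_def[symmetric] power2_diff field_simps)
    qed
    moreover have "\<alpha> ^ level (Suc (Suc k)) \<le> 1 / 50"
    proof -
      have "\<alpha> ^ level (Suc (Suc k)) \<le> \<alpha> ^ (64 * level (Suc k))"
        using \<alpha> by (intro power_decreasing level_gap) auto
      also have "\<dots> = x ^ 64"
        by (simp only: x_def power_mult[symmetric] mult.commute)
      also have "\<dots> \<le> (15 / 16) ^ 64"
        using x by (intro power_mono)
      also have "\<dots> \<le> 1 / 50" by (simp add: field_simps)
      finally show ?thesis .
    qed
    \<comment> \<open>The three contributions are \<open>1 - (15 / 16)\<^sup>2 = 31 / 256\<close>,
      \<open>1 / 4\<close> and \<open>1 / 50\<close>, with sum below \<open>2 / 5\<close>.\<close>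
    ultimately show ?case by (simp add: power2_eq_square)
  qed
qed

text \<open>The upper bound \<open>abel_lacunary_le\<close> is applied to the negated sequence,
  which equals \<open>-1\<close> on the chosen block, so the weight is
  \<open>w = -1\<close>.\<close>

lemma frequently_abel_ge:
  assumes c: "lacunary c"
    and one: "\<exists>\<^sub>F k in sequentially. \<forall>j. level (Suc k) \<le> j \<longrightarrow> j < 2 * level (Suc k) \<longrightarrow> c j = 1"
  shows "\<exists>\<^sub>F \<alpha> in at_left 1. 1 / 8 \<le> abel c \<alpha>"
proof (rule filterlim_frequently)
  \<comment> \<open>chosen such that \<open>x = 1/2\<close>, the maximiser of \<open>x - x\<^sup>2\<close>\<close>
  let ?\<beta> = "\<lambda>k. exp (- (ln 2 / real (level (Suc k))))"
  have "(\<lambda>k. ln 2 / real (level (Suc k))) \<longlonglongrightarrow> 0"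
    using filterlim_compose[OF filterlim_real_level filterlim_Suc]
    by (intro real_tendsto_divide_at_top[OF tendsto_const])
  then have "?\<beta> \<longlonglongrightarrow> exp (- 0)" by (intro tendsto_intros)
  then show "filterlim ?\<beta> (at_left 1) sequentially"
    using level_pos by (auto simp: filterlim_at eventually_sequentially)
  show "\<exists>\<^sub>F k in sequentially. 1 / 8 \<le> abel c (?\<beta> k)"
    using one
  proof (rule frequently_elim1)
    fix k assume k: "\<forall>j. level (Suc k) \<le> j \<longrightarrow> j < 2 * level (Suc k) \<longrightarrow> c j = 1"
    define \<beta> where "\<beta> = ?\<beta> k"
    have \<beta>: "0 < \<beta>" "\<beta> < 1" using level_pos by (auto simp: \<beta>_def)
    have half: "\<beta> ^ level (Suc k) = 1 / 2"
      using level_pos[of "Suc k"]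
      by (simp add: \<beta>_def exp_of_nat_mult[symmetric] exp_minus field_simps)
    have "abel (\<lambda>j. - c j) \<beta> \<le> 1 - \<beta> ^ (2 * level k)
        + (- 1) * (\<beta> ^ level (Suc k) - \<beta> ^ (2 * level (Suc k))) + \<beta> ^ level (Suc (Suc k))"
      by (rule abel_lacunary_le[OF lacunary_uminus[OF c] \<beta>]) (use k in auto)
    moreover have "\<beta> ^ (2 * level (Suc k)) = 1 / 4"
      by (simp only: mult.commute[of 2] power_mult half) (simp add: power2_eq_square)
    moreover have "31 / 32 \<le> \<beta> ^ (2 * level k)"
    proof -
      \<comment> \<open>With \<open>ln 2 \<le> 1\<close> and the level ratio 64, the exponent is at
        most \<open>1 / 32\<close>; then \<open>exp (- t) \<ge> 1 - t\<close>.\<close>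
      have "real (2 * level k) * ln 2 \<le> real (2 * level k) * 1"
        using ln_le_minus_one[of "2::real"] by (intro mult_left_mono) auto
      also have "\<dots> \<le> real (level (Suc k)) / 32"
        using level_gap[of k] by simp
      finally have "real (2 * level k) * (ln 2 / real (level (Suc k))) \<le> 1 / 32"
        using level_pos[of "Suc k"] by (simp add: field_simps)
      moreover have "\<beta> ^ (2 * level k) = exp (- (real (2 * level k) * (ln 2 / real (level (Suc k)))))"
        unfolding \<beta>_def by (simp add: exp_of_nat_mult[symmetric])
      ultimately show ?thesis
        using exp_ge_add_one_self[of "- (real (2 * level k) * (ln 2 / real (level (Suc k))))"] by linarith
    qed
    moreover have "\<beta> ^ level (Suc (Suc k)) \<le> 1 / 32"
    proof -
      have "\<beta> ^ level (Suc (Suc k)) \<le> \<beta> ^ (level (Suc k) * 64)"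
        using \<beta> level_gap[of "Suc k"] by (intro power_decreasing) (auto simp: mult.commute)
      also have "\<dots> \<le> 1 / 32"
        by (simp add: power_mult half power_divide)
      finally show ?thesis .
    qed
    moreover have "abel (\<lambda>j. - c j) \<beta> = - abel c \<beta>"
      using c \<beta> by (intro abel_uminus) (auto simp: lacunary_def)
    \<comment> \<open>The negated mean is at most
      \<open>1 / 32 - (1 / 2 - 1 / 4) + 1 / 32 = - 3 / 16\<close>.\<close>
    ultimately show "1 / 8 \<le> abel c (?\<beta> k)"
      by (simp add: half \<beta>_def[symmetric])
  qed
qed

text \<open>The mean is taken at the end of a block of ones, which fills half of the indices. The
  preceding gap contributes nothing, and the indices before it at worst \<open>-1\<close>
  each.\<close>

lemma frequently_cesaro_ge:
  assumes c: "lacunary c"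
    and one: "\<exists>\<^sub>F k in sequentially. \<forall>j. level (Suc k) \<le> j \<longrightarrow> j < 2 * level (Suc k) \<longrightarrow> c j = 1"
  shows "\<exists>\<^sub>F N in sequentially. 12 / 25 \<le> cesaro c N"
proof (rule filterlim_frequently)
  show "filterlim (\<lambda>k. 2 * level (Suc k)) sequentially sequentially"
    using strict_mono_level by (intro filterlim_subseq) (auto simp: strict_mono_def)
  show "\<exists>\<^sub>F k in sequentially. 12 / 25 \<le> cesaro c (2 * level (Suc k))"
    using one
  proof (rule frequently_elim1)
    fix k assume k: "\<forall>j. level (Suc k) \<le> j \<longrightarrow> j < 2 * level (Suc k) \<longrightarrow> c j = 1"
    let ?L = "level k" and ?L' = "level (Suc k)"
    have split: "{..<2 * ?L'} = {..<2 * ?L} \<union> {2 * ?L..<?L'} \<union> {?L'..<2 * ?L'}"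
      using level_gap[of k] by auto
    have "(\<Sum>j<2 * ?L'. c j) = (\<Sum>j<2 * ?L. c j) + (\<Sum>j=2 * ?L..<?L'. c j) + (\<Sum>j=?L'..<2 * ?L'. c j)"
      unfolding split using level_gap[of k] by (subst sum.union_disjoint; (subst sum.union_disjoint)?) auto
    moreover have "(\<Sum>j=2 * ?L..<?L'. c j) = 0"
      using c by (intro sum.neutral) (auto simp: lacunary_def)
    moreover have "(\<Sum>j=?L'..<2 * ?L'. c j) = (\<Sum>j=?L'..<2 * ?L'. 1)"
      using k by (intro sum.cong) auto
    moreover have "(\<Sum>j<2 * ?L. - 1) \<le> (\<Sum>j<2 * ?L. c j)"
      using c by (intro sum_mono) (auto simp: lacunary_def abs_le_iff minus_le_iff)
    ultimately have "real ?L' - 2 * real ?L \<le> (\<Sum>j<2 * ?L'. c j)" by simp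
    \<comment> \<open>Division by \<open>2 * ?L'\<close> gives at least
      \<open>1 / 2 - 1 / 64 = 31 / 64\<close>.\<close>
    then show "12 / 25 \<le> cesaro c (2 * ?L')"
      using level_gap[of k] level_pos[of "Suc k"] by (simp add: cesaro_def field_simps)
  qed
qed

text \<open>
  For \<open>\<alpha> = 1 - 1/L\<^sup>2\<close> the horizon \<open>1/(1 - \<alpha>) = L\<^sup>2\<close> lies well inside the gap \<open>[2L, L\<^sup>3)\<close>.
\<close>

lemma abel_gap_le:
  assumes c: "\<And>j. \<bar>c j\<bar> \<le> 1"
    and gap: "\<And>j. 2 * level k \<le> j \<Longrightarrow> j < level (Suc k) \<Longrightarrow> c j \<le> 0"
  shows "abel c (1 - 1 / (real (level k))\<^sup>2) \<le> 3 / level k"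
proof -
  let ?L = "level k"
  define \<alpha> :: real where "\<alpha> = 1 - 1 / (real ?L)\<^sup>2"
  have L: "1 < real ?L" using level_ge_8[of k] by simp
  then have \<alpha>: "0 < \<alpha>" "\<alpha> < 1" by (auto simp: \<alpha>_def)
  \<comment> \<open>No block has to be singled out here, hence the weight 0.\<close>
  have "abel c \<alpha> \<le> 1 - \<alpha> ^ (2 * ?L) + 0 * (\<alpha> ^ 0 - \<alpha> ^ 0) + \<alpha> ^ level (Suc k)"
  proof (rule abel_le_steps[OF c \<alpha>])
    show "c j \<le> 1 - of_bool (2 * ?L \<le> j) + 0 * (of_bool (0 \<le> j) - of_bool (0 \<le> j)) + of_bool (level (Suc k) \<le> j)" for j
      using gap[of j] c[of j] level_gap[of k] by auto
  qed
  \<comment> \<open>Bernoulli: the horizon \<open>L\<^sup>2\<close> is long compared with the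
    \<open>2 * L\<close> indices before the gap.\<close>
  moreover have "1 - 2 / ?L \<le> \<alpha> ^ (2 * ?L)"
    using Bernoulli_inequality[of "- (1 / (real ?L)\<^sup>2)" "2 * ?L"] L \<alpha>
    by (simp add: \<alpha>_def power2_eq_square)
  moreover have "\<alpha> ^ level (Suc k) \<le> 1 / ?L"
  proof -
    \<comment> \<open>The horizon is short compared with the end \<open>L ^ 3\<close> of the gap:
      \<open>exp (- 1 / L\<^sup>2)\<close> to the power \<open>L ^ 3\<close> is
      \<open>exp (- L)\<close>.\<close>
    have "\<alpha> ^ level (Suc k) \<le> exp (- (1 / (real ?L)\<^sup>2)) ^ level (Suc k)"
      using exp_ge_add_one_self[of "- (1 / (real ?L)\<^sup>2)"] \<alpha> by (intro power_mono) (auto simp: \<alpha>_def)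
    also have "\<dots> = exp (- real ?L)"
      using L by (simp add: exp_of_nat_mult[symmetric] level_Suc power2_eq_square power3_eq_cube)
    also have "\<dots> \<le> 1 / ?L"
      unfolding exp_minus inverse_eq_divide
    proof (rule frac_le)
      show "real ?L \<le> exp (real ?L)"
        using exp_ge_add_one_self[of "real ?L"] by linarith
    qed (use L in auto)
    finally show ?thesis .
  qed
  ultimately show ?thesis
    unfolding \<alpha>_def by simp
qed

text \<open>Up to the end of the gap only the first \<open>2 * level k\<close> terms can be
  positive. This gives \<open>2 / L\<^sup>2\<close> with \<open>L = level k\<close>; the weaker
  bound \<open>3 / L\<close> matches \<open>abel_gap_le\<close>.\<close>

lemma cesaro_gap_le:
  assumes c: "\<And>j. \<bar>c j\<bar> \<le> 1"
    and gap: "\<And>j. 2 * level k \<le> j \<Longrightarrow> j < level (Suc k) \<Longrightarrow> c j \<le> 0"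
  shows "cesaro c (level (Suc k)) \<le> 3 / level k"
proof -
  let ?L = "level k" and ?L' = "level (Suc k)"
  have "(\<Sum>j<?L'. c j) \<le> (\<Sum>j<?L'. of_bool (j < 2 * ?L))"
  proof (rule sum_mono)
    show "c j \<le> of_bool (j < 2 * ?L)" if "j \<in> {..<?L'}" for j
      using c[of j] gap[of j] that by auto
  qed
  also have "\<dots> = real (card ({..<?L'} \<inter> {j. j < 2 * ?L}))"
    by simp
  also have "\<dots> \<le> real (card {..<2 * ?L})"
    by (intro of_nat_mono card_mono) auto
  finally have "cesaro c ?L' \<le> 2 * ?L / ?L'"
    unfolding cesaro_def by (intro divide_right_mono) auto
  also have "\<dots> = 2 / (real ?L)\<^sup>2"
    using level_pos[of k] by (simp add: level_Suc power2_eq_square power3_eq_cube)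
  also have "\<dots> \<le> 3 / ?L"
    using level_ge_8[of k] by (simp add: field_simps power2_eq_square)
  finally show ?thesis .
qed

section \<open>Lower limits of sequences that take their minimal value on long gaps\<close>

lemma cesaro_diff_const: "0 < N \<Longrightarrow> cesaro (\<lambda>j. c j - e) N = cesaro c N - e"
  by (simp add: cesaro_def sum_subtractf diff_divide_distrib)

lemma abel_diff_const:
  assumes c: "\<And>j. \<bar>c j\<bar> \<le> 1" and \<alpha>: "0 < \<alpha>" "\<alpha> < 1"
  shows "abel (\<lambda>j. c j - e) \<alpha> = abel c \<alpha> - e"
proof -
  have "(\<lambda>j. \<alpha> ^ j * c j - \<alpha> ^ j * e) sums ((\<Sum>j. \<alpha> ^ j * c j) - 1 / (1 - \<alpha>) * e)"
    using \<alpha> by (intro sums_diff sums_mult2 geometric_sums summable_sums summable_abel c) auto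
  then have "(\<Sum>j. \<alpha> ^ j * (c j - e)) = (\<Sum>j. \<alpha> ^ j * c j) - 1 / (1 - \<alpha>) * e"
    by (simp add: right_diff_distrib sums_iff)
  then show ?thesis using \<alpha> by (simp add: abel_def right_diff_distrib)
qed

text \<open>As \<open>e\<close> is a lower bound of the sequence, both lower limits are at least
  \<open>e\<close>. Conversely, \<open>c - e\<close> has values in \<open>[0, 1]\<close> and
  vanishes on infinitely many gaps, where both gap estimates bring the means within
  \<open>3 / level k\<close> of \<open>e\<close>. Applied to a negated sequence, the lemma yields
  upper limits.\<close>

lemma gap_inf_eq:
  assumes c: "\<And>j. \<bar>c j\<bar> \<le> 1" and e: "\<And>j. e \<le> c j" "\<And>j. c j \<le> e + 1"
    and gap: "\<exists>\<^sub>F k in sequentially. \<forall>j. 2 * level k \<le> j \<longrightarrow> j < level (Suc k) \<longrightarrow> c j = e"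
  shows "cesaro_inf c = e" and "abel_inf c = e"
proof -
  let ?d = "\<lambda>j. c j - e"
  have d: "\<bar>?d j\<bar> \<le> 1" for j using e[of j] by auto
  have c': "- 1 \<le> c j" "c j \<le> 1" for j using c[of j] by auto
  have ev: "\<forall>\<^sub>F k in sequentially. 3 / real (level k) < \<epsilon>" if "0 < \<epsilon>" for \<epsilon>
  proof -
    have "(\<lambda>k. 3 / real (level k)) \<longlonglongrightarrow> 0"
      using filterlim_real_level by (intro real_tendsto_divide_at_top[OF tendsto_const])
    then show ?thesis using that by (rule order_tendstoD)
  qed
  have gap': "\<exists>\<^sub>F k in sequentially. 3 / real (level k) < \<epsilon> \<and> (\<forall>j. 2 * level k \<le> j \<longrightarrow> j < level (Suc k) \<longrightarrow> c j = e)"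
    if "0 < \<epsilon>" for \<epsilon>
    using gap ev[OF that] by (rule frequently_eventually_conj)

  show "cesaro_inf c = e"
  proof (rule antisym)
    have "0 \<le> cesaro ?d N" for N
      unfolding cesaro_def using e by (intro divide_nonneg_nonneg sum_nonneg) auto
    \<comment> \<open>\<open>N = 0\<close> is left out: there division by zero makes every Cesaro
      mean 0, and the shift by \<open>e\<close> fails in general.\<close>
    then have "\<forall>\<^sub>F N in sequentially. ereal e \<le> ereal (cesaro c N)"
      by (intro eventually_mono[OF eventually_gt_at_top[of 0]])
         (metis cesaro_diff_const diff_ge_0_iff_ge ereal_less_eq(3))
    then show "e \<le> cesaro_inf c" unfolding cesaro_inf_def by (rule Liminf_bounded)
    show "cesaro_inf c \<le> e"
    proof (rule ereal_le_epsilon2)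
      fix \<epsilon> :: real assume "0 < \<epsilon>"
      have "\<exists>\<^sub>F N in sequentially. cesaro c N \<le> e + \<epsilon>"
      proof (rule filterlim_frequently)
        show "filterlim (\<lambda>k. level (Suc k)) sequentially sequentially"
          by (rule filterlim_compose[OF filterlim_level filterlim_Suc])
        show "\<exists>\<^sub>F k in sequentially. cesaro c (level (Suc k)) \<le> e + \<epsilon>"
          using gap'[OF \<open>0 < \<epsilon>\<close>]
        proof (rule frequently_elim1)
          fix k assume "3 / real (level k) < \<epsilon> \<and> (\<forall>j. 2 * level k \<le> j \<longrightarrow> j < level (Suc k) \<longrightarrow> c j = e)"
          then show "cesaro c (level (Suc k)) \<le> e + \<epsilon>"
            using cesaro_gap_le[of ?d k] d cesaro_diff_const[OF level_pos, of c e "Suc k"] by force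
        qed
      qed
      then show "cesaro_inf c \<le> ereal e + ereal \<epsilon>"
        unfolding cesaro_inf_def by (intro frequently_Liminf_le) simp
    qed
  qed

  show "abel_inf c = e"
  proof (rule antisym)
    have "\<forall>\<^sub>F \<alpha> in at_left 1. ereal e \<le> ereal (abel c \<alpha>)"
      using eventually_at_left_1
    proof eventually_elim
      case (elim \<alpha>)
      have "0 \<le> abel ?d \<alpha>"
        unfolding abel_def using elim e d
        by (intro mult_nonneg_nonneg suminf_nonneg summable_abel) auto
      then show ?case using abel_diff_const[of c \<alpha> e] c elim by simp
    qed
    then show "e \<le> abel_inf c" unfolding abel_inf_def by (rule Liminf_bounded)
    show "abel_inf c \<le> e"
    proof (rule ereal_le_epsilon2)
      fix \<epsilon> :: real assume "0 < \<epsilon>"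
      let ?a = "\<lambda>k. 1 - 1 / (real (level k))\<^sup>2"
      have "\<exists>\<^sub>F \<alpha> in at_left 1. abel c \<alpha> \<le> e + \<epsilon>"
      proof (rule filterlim_frequently)
        have "(\<lambda>k. 1 / (real (level k))\<^sup>2) \<longlonglongrightarrow> 0"
          using filterlim_real_level
          by (intro real_tendsto_divide_at_top[OF tendsto_const] filterlim_pow_at_top) auto
        then have "?a \<longlonglongrightarrow> 1 - 0" by (intro tendsto_intros)
        then show "filterlim ?a (at_left 1) sequentially"
          using level_pos by (auto simp: filterlim_at)
        show "\<exists>\<^sub>F k in sequentially. abel c (?a k) \<le> e + \<epsilon>"
          using gap'[OF \<open>0 < \<epsilon>\<close>]
        proof (rule frequently_elim1)
          fix k assume k: "3 / real (level k) < \<epsilon> \<and> (\<forall>j. 2 * level k \<le> j \<longrightarrow> j < level (Suc k) \<longrightarrow> c j = e)"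
          have "1 < real (level k)" using level_ge_8[of k] by simp
          then have "0 < ?a k" "?a k < 1" by auto
          then have "abel ?d (?a k) = abel c (?a k) - e" by (intro abel_diff_const c)
          moreover have "abel ?d (?a k) \<le> 3 / level k"
            by (rule abel_gap_le) (use k d in auto)
          ultimately show "abel c (?a k) \<le> e + \<epsilon>" using k by simp
        qed
      qed
      then show "abel_inf c \<le> ereal e + ereal \<epsilon>"
        unfolding abel_inf_def by (intro frequently_Liminf_le) simp
    qed
  qed
qed

subsection \<open>The four sequences\<close>

text \<open>The definite description recovers the block index from \<open>j\<close>; it is well
  defined because the intervals between consecutive levels are disjoint.\<close>

definition block_seq :: "(nat \<Rightarrow> nat) \<Rightarrow> (nat \<Rightarrow> real) \<Rightarrow> nat \<Rightarrow> real" where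
  "block_seq m w j =
     (if \<exists>k. level k \<le> j \<and> j < m k then w (THE k. level k \<le> j \<and> j < level (Suc k)) else 0)"

lemma level_interval_unique:
  assumes "level k \<le> j" "j < level (Suc k)" "level l \<le> j" "j < level (Suc l)"
  shows "k = l"
proof -
  have "level k < level (Suc l)" "level l < level (Suc k)" using assms by linarith+
  then show ?thesis using strict_mono_less[OF strict_mono_level] by (metis less_Suc_eq not_less_eq)
qed

lemma block_seq_eq:
  assumes m: "\<And>k. m k \<le> level (Suc k)" and "level k \<le> j" "j < level (Suc k)"
  shows "block_seq m w j = (if j < m k then w k else 0)"
proof -
  have "(THE k. level k \<le> j \<and> j < level (Suc k)) = k"
    using assms level_interval_unique by (intro the_equality) auto
  moreover have "(\<exists>l. level l \<le> j \<and> j < m l) \<longleftrightarrow> j < m k"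
    using assms level_interval_unique[of k j] by (metis less_le_trans)
  ultimately show ?thesis by (simp add: block_seq_def)
qed

lemma block_seq_cases:
  assumes "\<And>k. w k \<in> A" "0 \<in> A"
  shows "block_seq m w j \<in> A"
  using assms by (simp add: block_seq_def)

lemma lacunary_block_seq:
  assumes "\<And>k. \<bar>w k\<bar> \<le> 1"
  shows "lacunary (block_seq (\<lambda>k. 2 * level k) w)"
  unfolding lacunary_def
proof safe
  show "\<bar>block_seq (\<lambda>k. 2 * level k) w j\<bar> \<le> 1" for j
    using block_seq_cases[of w "{-1..1}" "\<lambda>k. 2 * level k" j] assms by (auto simp: abs_le_iff minus_le_iff)
  show "block_seq (\<lambda>k. 2 * level k) w j = 0" if "2 * level k \<le> j" "j < level (Suc k)" for k j
  proof (subst block_seq_eq[of _ k])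
    show "2 * level k \<le> level (Suc k)" for k using level_gap[of k] by linarith
  qed (use that in auto)
qed

lemma block_seq_on_block:
  assumes "level k \<le> j" "j < 2 * level k"
  shows "block_seq (\<lambda>k. 2 * level k) w j = w k"
proof (subst block_seq_eq[of _ k])
  show "2 * level k \<le> level (Suc k)" for k using level_gap[of k] by linarith
  then show "j < level (Suc k)" using assms(2) by (rule less_le_trans[rotated])
qed (use assms in auto)

lemma frequently_even: "\<exists>\<^sub>F k in sequentially. even k"
  and frequently_odd: "\<exists>\<^sub>F k in sequentially. odd k"
proof -
  have "\<exists>n\<ge>N. even n" "\<exists>n\<ge>N. odd n" for N :: nat
    by (rule exI[of _ "2 * N"], simp, rule exI[of _ "2 * N + 1"], simp)
  then show "\<exists>\<^sub>F k in sequentially. even k" "\<exists>\<^sub>F k in sequentially. odd k"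
    by (auto simp: frequently_sequentially)
qed

text \<open>The constants \<open>1 / 8\<close>, \<open>2 / 5\<close> and \<open>12 / 25\<close> of
  the preceding estimates separate 0, the Abel limit and the Cesaro limit.\<close>

lemma lacunary_abel_sup_less:
  assumes "lacunary c"
    and one: "\<exists>\<^sub>F k in sequentially. \<forall>j. level (Suc k) \<le> j \<longrightarrow> j < 2 * level (Suc k) \<longrightarrow> c j = 1"
  shows "abel_sup c < cesaro_sup c" and "0 < abel_sup c"
proof -
  have "abel_sup c \<le> ereal (2 / 5)"
    unfolding abel_sup_def
    using eventually_abel_le[OF assms(1)] by (intro Limsup_bounded) simp
  also have "ereal (2 / 5) < ereal (12 / 25)" by simp
  also have "ereal (12 / 25) \<le> cesaro_sup c"
    unfolding cesaro_sup_def
    using frequently_cesaro_ge[OF assms] by (intro frequently_le_Limsup) simp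
  finally show "abel_sup c < cesaro_sup c" .
  have "0 < ereal (1 / 8)" by simp
  also have "ereal (1 / 8) \<le> abel_sup c"
    unfolding abel_sup_def
    using frequently_abel_ge[OF assms] by (intro frequently_le_Limsup) simp
  finally show "0 < abel_sup c" .
qed

lemma ex_seq_strict_strict:
  obtains c where "\<And>j. \<bar>c j\<bar> \<le> 1"
    "cesaro_inf c < abel_inf c" "abel_inf c < abel_sup c" "abel_sup c < cesaro_sup c"
proof -
  define c where "c = block_seq (\<lambda>k. 2 * level k) (\<lambda>k. (- 1) ^ k)"
  have lac: "lacunary c" unfolding c_def by (intro lacunary_block_seq) (simp add: power_abs)
  have b: "\<bar>c j\<bar> \<le> 1" for j using lac by (auto simp: lacunary_def)
  have blk: "c j = (- 1) ^ k" if "level k \<le> j" "j < 2 * level k" for k j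
    unfolding c_def using that by (rule block_seq_on_block)
  \<comment> \<open>The block in question has index \<open>Suc k\<close>, so odd \<open>k\<close>
    give the value 1 and even \<open>k\<close> the value \<open>-1\<close>.\<close>
  have "\<exists>\<^sub>F k in sequentially. \<forall>j. level (Suc k) \<le> j \<longrightarrow> j < 2 * level (Suc k) \<longrightarrow> c j = 1"
    using frequently_odd by (rule frequently_elim1) (auto simp: blk)
  note sup = lacunary_abel_sup_less[OF lac this]
  have "\<exists>\<^sub>F k in sequentially. \<forall>j. level (Suc k) \<le> j \<longrightarrow> j < 2 * level (Suc k) \<longrightarrow> - c j = 1"
    using frequently_even by (rule frequently_elim1) (auto simp: blk)
  note inf = lacunary_abel_sup_less[OF lacunary_uminus[OF lac] this]
  have "cesaro_inf c < abel_inf c" "abel_inf c < 0"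
    using inf by (simp_all add: cesaro_sup_uminus abel_sup_uminus b ereal_less_uminus_reorder)
  with sup b show thesis by (intro that[of c]) auto
qed

lemma ex_seq_eq_strict:
  obtains c where "\<And>j. \<bar>c j\<bar> \<le> 1"
    "cesaro_inf c = abel_inf c" "abel_inf c < abel_sup c" "abel_sup c < cesaro_sup c"
proof -
  define c where "c = block_seq (\<lambda>k. 2 * level k) (\<lambda>k. 1)"
  have lac: "lacunary c" unfolding c_def by (intro lacunary_block_seq) simp
  have b: "\<bar>c j\<bar> \<le> 1" for j using lac by (auto simp: lacunary_def)
  have b': "0 \<le> c j" "c j \<le> 0 + 1" for j
    using block_seq_cases[of "\<lambda>_. 1" "{0..1}"] by (auto simp: c_def)
  have blk: "c j = 1" if "level k \<le> j" "j < 2 * level k" for k j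
    unfolding c_def using that by (rule block_seq_on_block)
  have "\<exists>\<^sub>F k in sequentially. \<forall>j. level (Suc k) \<le> j \<longrightarrow> j < 2 * level (Suc k) \<longrightarrow> c j = 1"
    using blk by simp
  note sup = lacunary_abel_sup_less[OF lac this]
  have "\<exists>\<^sub>F k in sequentially. \<forall>j. 2 * level k \<le> j \<longrightarrow> j < level (Suc k) \<longrightarrow> c j = 0"
    using lac by (simp add: lacunary_def)
  then have "cesaro_inf c = 0" "abel_inf c = 0"
    using gap_inf_eq[of c 0] b b' by (auto simp: zero_ereal_def)
  with sup b show thesis by (intro that[of c]) auto
qed

lemma ex_seq_eq_eq:
  obtains c where "\<And>j. \<bar>c j\<bar> \<le> 1"
    "cesaro_inf c = abel_inf c" "abel_inf c < abel_sup c" "abel_sup c = cesaro_sup c"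
proof -
  define c where "c = block_seq (\<lambda>k. level (Suc k)) (\<lambda>k. of_bool (even k))"
  have b': "0 \<le> c j" "c j \<le> 0 + 1" for j
    using block_seq_cases[of "\<lambda>k. of_bool (even k)" "{0..1}"] by (auto simp: c_def)
  then have b: "\<bar>c j\<bar> \<le> 1" for j by (simp add: abs_le_iff)
  \<comment> \<open>Here the blocks fill the whole interval between levels; the part from
    \<open>2 * level k\<close> on serves as the gap in \<open>gap_inf_eq\<close>.\<close>
  have blk: "c j = of_bool (even k)" if "2 * level k \<le> j" "j < level (Suc k)" for k j
    unfolding c_def using that by (subst block_seq_eq[of _ k]) auto
  have "\<exists>\<^sub>F k in sequentially. \<forall>j. 2 * level k \<le> j \<longrightarrow> j < level (Suc k) \<longrightarrow> c j = 0"
    using frequently_odd by (rule frequently_elim1) (auto simp: blk)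
  then have inf: "cesaro_inf c = 0" "abel_inf c = 0"
    using gap_inf_eq[of c 0] b b' by (auto simp: zero_ereal_def)
  \<comment> \<open>For the upper limits, the blocks of ones become gaps of the negated sequence at
    its minimal value \<open>-1\<close>.\<close>
  have "\<exists>\<^sub>F k in sequentially. \<forall>j. 2 * level k \<le> j \<longrightarrow> j < level (Suc k) \<longrightarrow> - c j = - 1"
    using frequently_even by (rule frequently_elim1) (auto simp: blk)
  then have "cesaro_inf (\<lambda>j. - c j) = ereal (- 1)" "abel_inf (\<lambda>j. - c j) = ereal (- 1)"
    using gap_inf_eq[of "\<lambda>j. - c j" "- 1"] b b' by auto
  then have "- cesaro_sup c = - 1" "- abel_sup c = - 1"
    by (simp_all add: cesaro_inf_uminus abel_inf_uminus b one_ereal_def)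
  then have "cesaro_sup c = 1" "abel_sup c = 1"
    by (simp_all add: ereal_uminus_eq_reorder)
  with inf b show thesis by (intro that[of c]) auto
qed

text \<open>The mirror image of \<open>ex_seq_eq_strict\<close>: negation moves the equality from
  the lower limits to the upper ones.\<close>

lemma ex_seq_strict_eq:
  obtains c where "\<And>j. \<bar>c j\<bar> \<le> 1"
    "cesaro_inf c < abel_inf c" "abel_inf c < abel_sup c" "abel_sup c = cesaro_sup c"
proof -
  obtain d where "\<And>j. \<bar>d j\<bar> \<le> 1"
    "cesaro_inf d = abel_inf d" "abel_inf d < abel_sup d" "abel_sup d < cesaro_sup d"
    by (rule ex_seq_eq_strict) blast
  then show thesis
    by (intro that[of "\<lambda>j. - d j"])
       (simp_all add: cesaro_inf_uminus cesaro_sup_uminus abel_inf_uminus abel_sup_uminus)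
qed

theorem mainTheorem3:
  shows
    "(\<exists>(M :: (nat, real) mdp) x \<pi>.
        is_mdp M \<and> finite (states M) \<and> x \<in> states M \<and> is_policy M \<pi> \<and>
        lower_average M x \<pi> < lower_abel M x \<pi> \<and>
        lower_abel M x \<pi> < upper_abel M x \<pi> \<and>
        upper_abel M x \<pi> < upper_average M x \<pi>) \<and>
     (\<exists>(M :: (nat, real) mdp) x \<pi>.
        is_mdp M \<and> finite (states M) \<and> x \<in> states M \<and> is_policy M \<pi> \<and>
        lower_average M x \<pi> = lower_abel M x \<pi> \<and>
        lower_abel M x \<pi> < upper_abel M x \<pi> \<and>
        upper_abel M x \<pi> = upper_average M x \<pi>) \<and>
     (\<exists>(M :: (nat, real) mdp) x \<pi>.
        is_mdp M \<and> finite (states M) \<and> x \<in> states M \<and> is_policy M \<pi> \<and>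
        lower_average M x \<pi> < lower_abel M x \<pi> \<and>
        lower_abel M x \<pi> < upper_abel M x \<pi> \<and>
        upper_abel M x \<pi> = upper_average M x \<pi>) \<and>
     (\<exists>(M :: (nat, real) mdp) x \<pi>.
        is_mdp M \<and> finite (states M) \<and> x \<in> states M \<and> is_policy M \<pi> \<and>
        lower_average M x \<pi> = lower_abel M x \<pi> \<and>
        lower_abel M x \<pi> < upper_abel M x \<pi> \<and>
        upper_abel M x \<pi> < upper_average M x \<pi>)"
proof (intro conjI)
  \<comment> \<open>With \<open>R\<close> and \<open>S\<close> ranging over strict inequality and
    equality, one transfer statement serves all four relations.\<close>
  have mdp: "\<exists>(M :: (nat, real) mdp) x \<pi>.
      is_mdp M \<and> finite (states M) \<and> x \<in> states M \<and> is_policy M \<pi> \<and>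
      R (lower_average M x \<pi>) (lower_abel M x \<pi>) \<and>
      lower_abel M x \<pi> < upper_abel M x \<pi> \<and>
      S (upper_abel M x \<pi>) (upper_average M x \<pi>)"
    if "\<And>j. \<bar>c j\<bar> \<le> 1" "R (cesaro_inf c) (abel_inf c)" "abel_inf c < abel_sup c" "S (abel_sup c) (cesaro_sup c)"
    for c and R S :: "ereal \<Rightarrow> ereal \<Rightarrow> bool"
    using ex_mdp_cesaro_abel[of c, OF that(1)] that(2-4)
    unfolding cesaro_inf_def cesaro_sup_def abel_inf_def abel_sup_def by metis
  show "\<exists>(M :: (nat, real) mdp) x \<pi>.
        is_mdp M \<and> finite (states M) \<and> x \<in> states M \<and> is_policy M \<pi> \<and>
        lower_average M x \<pi> < lower_abel M x \<pi> \<and>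
        lower_abel M x \<pi> < upper_abel M x \<pi> \<and>
        upper_abel M x \<pi> < upper_average M x \<pi>"
    by (rule ex_seq_strict_strict, rule mdp)
  show "\<exists>(M :: (nat, real) mdp) x \<pi>.
        is_mdp M \<and> finite (states M) \<and> x \<in> states M \<and> is_policy M \<pi> \<and>
        lower_average M x \<pi> = lower_abel M x \<pi> \<and>
        lower_abel M x \<pi> < upper_abel M x \<pi> \<and>
        upper_abel M x \<pi> = upper_average M x \<pi>"
    by (rule ex_seq_eq_eq, rule mdp)
  show "\<exists>(M :: (nat, real) mdp) x \<pi>.
        is_mdp M \<and> finite (states M) \<and> x \<in> states M \<and> is_policy M \<pi> \<and>
        lower_average M x \<pi> < lower_abel M x \<pi> \<and>
        lower_abel M x \<pi> < upper_abel M x \<pi> \<and>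
        upper_abel M x \<pi> = upper_average M x \<pi>"
    by (rule ex_seq_strict_eq, rule mdp)
  show "\<exists>(M :: (nat, real) mdp) x \<pi>.
        is_mdp M \<and> finite (states M) \<and> x \<in> states M \<and> is_policy M \<pi> \<and>
        lower_average M x \<pi> = lower_abel M x \<pi> \<and>
        lower_abel M x \<pi> < upper_abel M x \<pi> \<and>
        upper_abel M x \<pi> < upper_average M x \<pi>"
    by (rule ex_seq_eq_strict, rule mdp)
qed

end
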